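(* For any positive integers $n,s,t$, $$\hat r_{\mathrm{edge}}(K_{1,n}^{\prec},K_{s,t}^{\prec})\le s^2(n-1)+st .$$ Moreover, the upper bound is sharp, i.e. there are positive integers $n,s,t$ for which equality holds.
   Context: All graphs are finite, simple and undirected. An edge-ordered graph $G^{\prec}$ is a pair $(G,\prec)$ of a graph $G$ and a linear order $\prec$ on $E(G)$. $G^{\prec}$ is an edge-ordered subgraph of $H^{\prec}$ if $G$ is a subgraph of $H$ and the edge order of $G$ is the restriction of the edge order of $H$. Two edge-ordered graphs are isomorphic if there is a graph isomorphism whose induced map on edges preserves the edge orders. An edge-ordered copy of $G^{\prec}$ in $F^{\prec}$ is an edge-ordered subgraph of $F^{\prec}$ isomorphic to $G^{\prec}$. For edge-ordered graphs $G^{\prec},H^{\prec}$, the size edge-ordered Ramsey number $\hat r_{\mathrm{edge}}(G^{\prec},H^{\prec})$ is the minimum number $N$ such that there exists an edge-ordered graph $F^{\prec}$ with $N$ edges such that every red/blue coloring of the edges of $F^{\prec}$ contains a red edge-ordered copy of $G^{\prec}$ or a blue edge-ordered copy of $H^{\prec}$. $K_{1,n}^{\prec}$ is the star with center $v$ and leaves $v_1,\dots,v_n$ and edge order $vv_1\prec vv_2\prec\cdots\prec vv_n$. $K_{s,t}^{\prec}$ is the complete bipartite graph with partite sets $A=\{u_1,\dots,u_s\}$ and $B=\{v_1,\dots,v_t\}$ and the vertex-lexicographic edge order: $u_iv_j\prec u_kv_l$ iff $i<k$, or $i=k$ and $j<l$ (for $1\le i,k\le s$, $1\le j,l\le t$).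 *)

theory Defs
  imports Main "HOL-Library.Extended_Nat"
begin

record 'a eograph =
  verts :: "'a set"
  edges :: "'a set set"
  edge_less :: "('a set \<times> 'a set) set"

text \<open>
  The library predicate \<open>strict_linear_order_on\<close> does not confine the relation to the given
  set, hence the first conjunct on \<open>edge_less\<close>.
\<close>

definition edge_ordered_graph :: "'a eograph \<Rightarrow> bool" where
  "edge_ordered_graph G \<longleftrightarrow>
     finite (verts G) \<and>
     (\<forall>e\<in>edges G. e \<subseteq> verts G \<and> card e = 2) \<and>
     edge_less G \<subseteq> edges G \<times> edges G \<and>
     strict_linear_order_on (edges G) (edge_less G)"

definition eo_subgraph :: "'a eograph \<Rightarrow> 'a eograph \<Rightarrow> bool" where
  "eo_subgraph G H \<longleftrightarrow>
     edge_ordered_graph G \<and> edge_ordered_graph H \<and>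
     verts G \<subseteq> verts H \<and> edges G \<subseteq> edges H \<and>
     edge_less G = edge_less H \<inter> (edges G \<times> edges G)"

definition eo_isomorphic :: "'a eograph \<Rightarrow> 'b eograph \<Rightarrow> bool" where
  "eo_isomorphic G H \<longleftrightarrow>
     (\<exists>f. bij_betw f (verts G) (verts H) \<and>
          (\<forall>u\<in>verts G. \<forall>v\<in>verts G. {u, v} \<in> edges G \<longleftrightarrow> {f u, f v} \<in> edges H) \<and>
          (\<forall>e\<in>edges G. \<forall>e'\<in>edges G.
             (e, e') \<in> edge_less G \<longleftrightarrow> (f ` e, f ` e') \<in> edge_less H))"

definition eo_copy :: "'a eograph \<Rightarrow> 'b eograph \<Rightarrow> 'b eograph \<Rightarrow> bool" where
  "eo_copy G F C \<longleftrightarrow> eo_subgraph C F \<and> eo_isomorphic G C"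

datatype colour = Red | Blue

definition edge_arrows :: "'c eograph \<Rightarrow> 'a eograph \<Rightarrow> 'b eograph \<Rightarrow> bool" where
  "edge_arrows F G H \<longleftrightarrow>
     (\<forall>c :: 'c set \<Rightarrow> colour.
        (\<exists>C. eo_copy G F C \<and> (\<forall>e\<in>edges C. c e = Red)) \<or>
        (\<exists>C. eo_copy H F C \<and> (\<forall>e\<in>edges C. c e = Blue)))"

text \<open>
  Every finite graph is isomorphic to one with vertices in \<^typ>\<open>nat\<close>, so the host graph may be
  taken there. The minimum is formed in \<^typ>\<open>enat\<close>, where it would be \<open>\<infinity>\<close> if no host graph
  existed; a finite upper bound thus includes the existence of a host graph.
\<close>

definition size_edge_ramsey :: "'a eograph \<Rightarrow> 'b eograph \<Rightarrow> enat" where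
  "size_edge_ramsey G H =
     Inf {enat N | N. \<exists>F :: nat eograph.
            edge_ordered_graph F \<and> card (edges F) = N \<and> edge_arrows F G H}"

text \<open>The centre of the star is \<open>0\<close>, its leaves are \<open>1, \<dots>, n\<close>.\<close>

definition ordered_star :: "nat \<Rightarrow> nat eograph" where
  "ordered_star n =
     \<lparr>verts = {0..n},
      edges = {{0, i} | i. i \<in> {1..n}},
      edge_less = {({0, i}, {0, j}) | i j. i \<in> {1..n} \<and> j \<in> {1..n} \<and> i < j}\<rparr>"

text \<open>\<^term>\<open>Inl i\<close> stands for $u_i$ and \<^term>\<open>Inr j\<close> for $v_j$.\<close>

definition ordered_biclique :: "nat \<Rightarrow> nat \<Rightarrow> (nat + nat) eograph" where
  "ordered_biclique s t =
     \<lparr>verts = Inl ` {1..s} \<union> Inr ` {1..t},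
      edges = {{Inl i, Inr j} | i j. i \<in> {1..s} \<and> j \<in> {1..t}},
      edge_less = {({Inl i, Inr j}, {Inl k, Inr l}) | i j k l.
        i \<in> {1..s} \<and> j \<in> {1..t} \<and> k \<in> {1..s} \<and> l \<in> {1..t} \<and>
        (i < k \<or> i = k \<and> j < l)}\<rparr>"

lemma edge_ordered_graph_ordered_star: "edge_ordered_graph (ordered_star n)"
  unfolding edge_ordered_graph_def ordered_star_def strict_linear_order_on_def
  by (auto simp: trans_def irrefl_def total_on_def doubleton_eq_iff) 

lemma edge_ordered_graph_ordered_biclique: "edge_ordered_graph (ordered_biclique s t)"
  unfolding edge_ordered_graph_def ordered_biclique_def strict_linear_order_on_def
  by (auto simp: trans_def irrefl_def total_on_def doubleton_eq_iff)

end

theory Submission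
  imports Defs "HOL-Library.Countable"
begin

text \<open>
  The upper bound is witnessed by \<open>ordered_biclique s m\<close> with \<open>m = s * (n - 1) + t\<close>, which has
  \<open>s * m\<close> edges. The edges at a vertex \<open>Inl i\<close> are ordered by their other endpoints, so any \<open>n\<close>
  red ones form a red ordered star. If there is no red star, then each of the \<open>s\<close> vertices
  \<open>Inl i\<close> is joined in red to at most \<open>n - 1\<close> vertices, so at least \<open>t\<close> of the vertices
  \<open>Inr j\<close> are incident to no red edge. Listed increasingly, \<open>t\<close> of these span, together with all
  \<open>Inl i\<close>, a blue copy of \<open>ordered_biclique s t\<close>: the lexicographic order is inherited by increasing
  choices of vertices (lemma \<open>biclique_red_star_or_blue_biclique\<close>).

  For sharpness, a host with fewer than \<open>e(G) + e(H) - 1\<close> edges can be coloured with fewer than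
  \<open>e(G)\<close> red and fewer than \<open>e(H)\<close> blue edges, which leaves no room for either copy
  (lemma \<open>size_edge_ramsey_ge\<close>). For \<open>s = 1\<close> this counting bound is \<open>n + t - 1\<close>, the same as the
  upper bound.
\<close>

section \<open>Embeddings and copies\<close>

text \<open>
  Copies are produced from vertex maps. Asking only for the forward direction on edges and on
  the order is enough: a copy need not be an induced subgraph, and the order of \<open>G\<close> is total.
\<close>

definition eo_embedding :: "('a \<Rightarrow> 'b) \<Rightarrow> 'a eograph \<Rightarrow> 'b eograph \<Rightarrow> bool" where
  "eo_embedding f G F \<longleftrightarrow>
     inj_on f (verts G) \<and> f ` verts G \<subseteq> verts F \<and>
     (\<forall>e\<in>edges G. f ` e \<in> edges F) \<and>
     (\<forall>e e'. (e, e') \<in> edge_less G \<longrightarrow> (f ` e, f ` e') \<in> edge_less F)"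

definition relabel :: "('a \<Rightarrow> 'b) \<Rightarrow> 'a eograph \<Rightarrow> 'b eograph" where
  "relabel f G =
     \<lparr>verts = f ` verts G,
      edges = (\<lambda>e. f ` e) ` edges G,
      edge_less = map_prod (\<lambda>e. f ` e) (\<lambda>e. f ` e) ` edge_less G\<rparr>"

lemma finite_edges:
  assumes "edge_ordered_graph G"
  shows "finite (edges G)"
proof (rule finite_subset)
  show "edges G \<subseteq> Pow (verts G)"
    using assms by (auto simp: edge_ordered_graph_def)
  show "finite (Pow (verts G))"
    using assms by (simp add: edge_ordered_graph_def)
qed

lemma inj_on_image_edges:
  assumes "edge_ordered_graph G" "inj_on f (verts G)"
  shows "inj_on (\<lambda>e. f ` e) (edges G)"
proof (rule inj_on_subset)
  show "inj_on (\<lambda>e. f ` e) (Pow (verts G))"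
    using assms(2) by (rule inj_on_image_Pow)
  show "edges G \<subseteq> Pow (verts G)"
    using assms(1) by (auto simp: edge_ordered_graph_def)
qed

lemma edge_less_relabel_iff:
  assumes "edge_ordered_graph G" "inj_on f (verts G)" "e \<in> edges G" "e' \<in> edges G"
  shows "(f ` e, f ` e') \<in> edge_less (relabel f G) \<longleftrightarrow> (e, e') \<in> edge_less G"
proof
  assume "(f ` e, f ` e') \<in> edge_less (relabel f G)"
  then obtain d d' where d: "(d, d') \<in> edge_less G" "f ` e = f ` d" "f ` e' = f ` d'"
    by (auto simp: relabel_def)
  have "d \<in> edges G" "d' \<in> edges G"
    using d(1) assms(1) by (auto simp: edge_ordered_graph_def)
  then have "d = e" "d' = e'"
    using inj_on_image_edges[OF assms(1,2)] assms(3,4) d(2,3) by (auto dest: inj_onD)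
  then show "(e, e') \<in> edge_less G"
    using d(1) by simp
next
  assume "(e, e') \<in> edge_less G"
  then have "map_prod (\<lambda>e. f ` e) (\<lambda>e. f ` e) (e, e') \<in> edge_less (relabel f G)"
    unfolding relabel_def eograph.simps by (rule imageI)
  then show "(f ` e, f ` e') \<in> edge_less (relabel f G)" by simp
qed

lemma edge_ordered_graph_relabel:
  assumes "edge_ordered_graph G" "inj_on f (verts G)"
  shows "edge_ordered_graph (relabel f G)"
proof -
  note iff = edge_less_relabel_iff[OF assms]
  have sub: "edge_less (relabel f G) \<subseteq> edges (relabel f G) \<times> edges (relabel f G)"
    using assms(1) by (auto simp: edge_ordered_graph_def relabel_def)
  have ord: "trans (edge_less G)" "irrefl (edge_less G)" "total_on (edges G) (edge_less G)"
    using assms(1) by (auto simp: edge_ordered_graph_def strict_linear_order_on_def)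
  have ed: "edges (relabel f G) = (\<lambda>e. f ` e) ` edges G"
    by (simp add: relabel_def)
  have "trans (edge_less (relabel f G))"
  proof (rule transI)
    fix x y z
    assume xy: "(x, y) \<in> edge_less (relabel f G)" and yz: "(y, z) \<in> edge_less (relabel f G)"
    then have "x \<in> edges (relabel f G)" "y \<in> edges (relabel f G)" "z \<in> edges (relabel f G)"
      using sub by auto
    then obtain a b c where abc: "a \<in> edges G" "b \<in> edges G" "c \<in> edges G"
      and eq: "x = f ` a" "y = f ` b" "z = f ` c"
      unfolding ed by (elim imageE)
    have "(a, b) \<in> edge_less G" "(b, c) \<in> edge_less G"
      using xy yz abc iff unfolding eq by simp_all
    then have "(a, c) \<in> edge_less G"
      by (rule transD[OF ord(1)])
    then show "(x, z) \<in> edge_less (relabel f G)"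
      using abc iff unfolding eq by simp
  qed
  moreover have "irrefl (edge_less (relabel f G))"
  proof (rule irreflI, rule notI)
    fix x
    assume x: "(x, x) \<in> edge_less (relabel f G)"
    then have "x \<in> edges (relabel f G)"
      using sub by auto
    then obtain a where a: "a \<in> edges G" "x = f ` a"
      unfolding ed by (elim imageE)
    then have "(a, a) \<in> edge_less G"
      using x iff by simp
    then show False
      using ord(2) by (auto simp: irrefl_def)
  qed
  moreover have "total_on (edges (relabel f G)) (edge_less (relabel f G))"
  proof (rule total_onI)
    fix x y
    assume "x \<in> edges (relabel f G)" "y \<in> edges (relabel f G)" and neq: "x \<noteq> y"
    then obtain a b where ab: "a \<in> edges G" "b \<in> edges G" and eq: "x = f ` a" "y = f ` b"
      unfolding ed by (elim imageE)
    have "a \<noteq> b"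
      using neq eq by auto
    then have "(a, b) \<in> edge_less G \<or> (b, a) \<in> edge_less G"
      using ord(3) ab by (auto simp: total_on_def)
    then show "(x, y) \<in> edge_less (relabel f G) \<or> (y, x) \<in> edge_less (relabel f G)"
      using ab iff unfolding eq by simp
  qed
  moreover have "\<forall>e\<in>edges (relabel f G). e \<subseteq> verts (relabel f G) \<and> card e = 2"
  proof
    fix d
    assume "d \<in> edges (relabel f G)"
    then obtain e where e: "e \<in> edges G" "d = f ` e"
      unfolding ed by (elim imageE)
    then have sub_e: "e \<subseteq> verts G" and "card e = 2"
      using assms(1) by (auto simp: edge_ordered_graph_def)
    then have "card d = 2"
      using card_image[OF inj_on_subset[OF assms(2) sub_e]] e(2) by simp
    moreover have "d \<subseteq> verts (relabel f G)"
      using sub_e e(2) by (auto simp: relabel_def)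
    ultimately show "d \<subseteq> verts (relabel f G) \<and> card d = 2" by simp
  qed
  moreover have "finite (verts (relabel f G))"
    using assms(1) by (simp add: edge_ordered_graph_def relabel_def)
  ultimately show ?thesis
    using sub unfolding edge_ordered_graph_def strict_linear_order_on_def by simp
qed

lemma eo_isomorphic_relabel:
  assumes "edge_ordered_graph G" "inj_on f (verts G)"
  shows "eo_isomorphic G (relabel f G)"
  unfolding eo_isomorphic_def
proof (intro exI conjI ballI)
  show "bij_betw f (verts G) (verts (relabel f G))"
    using assms(2) by (simp add: relabel_def bij_betw_def)
next
  fix u v
  assume uv: "u \<in> verts G" "v \<in> verts G"
  show "{u, v} \<in> edges G \<longleftrightarrow> {f u, f v} \<in> edges (relabel f G)"
  proof
    assume "{f u, f v} \<in> edges (relabel f G)"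
    then obtain e where e: "e \<in> edges G" "f ` {u, v} = f ` e"
      by (auto simp: relabel_def)
    have "e \<subseteq> verts G"
      using e(1) assms(1) by (auto simp: edge_ordered_graph_def)
    then have "{u, v} = e"
      using e(2) uv inj_on_image_eq_iff[OF assms(2), of "{u, v}" e] by simp
    then show "{u, v} \<in> edges G"
      using e(1) by simp
  next
    assume "{u, v} \<in> edges G"
    then have "f ` {u, v} \<in> edges (relabel f G)"
      unfolding relabel_def eograph.simps by (rule imageI)
    then show "{f u, f v} \<in> edges (relabel f G)" by simp
  qed
next
  fix e e'
  assume "e \<in> edges G" "e' \<in> edges G"
  then show "(e, e') \<in> edge_less G \<longleftrightarrow> (f ` e, f ` e') \<in> edge_less (relabel f G)"
    using edge_less_relabel_iff[OF assms] by simp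
qed

text \<open>
  The delicate point is that the image carries exactly the order of \<open>F\<close>: if \<open>F\<close> put two image
  edges the other way round, totality of \<open>G\<close> would give both comparisons in \<open>F\<close>.
\<close>

lemma eo_copy_relabel:
  assumes G: "edge_ordered_graph G" and F: "edge_ordered_graph F" and f: "eo_embedding f G F"
  shows "eo_copy G F (relabel f G)"
proof -
  have inj: "inj_on f (verts G)"
    using f by (simp add: eo_embedding_def)
  have mono: "(f ` e, f ` e') \<in> edge_less F" if "(e, e') \<in> edge_less G" for e e'
    using f that by (auto simp: eo_embedding_def)
  have trF: "trans (edge_less F)" and irF: "irrefl (edge_less F)"
    using F by (auto simp: edge_ordered_graph_def strict_linear_order_on_def)
  have totG: "total_on (edges G) (edge_less G)"
    using G by (auto simp: edge_ordered_graph_def strict_linear_order_on_def)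
  have reflects: "(e, e') \<in> edge_less G"
    if "e \<in> edges G" "e' \<in> edges G" "(f ` e, f ` e') \<in> edge_less F" for e e'
  proof (rule ccontr)
    assume no: "(e, e') \<notin> edge_less G"
    have "e \<noteq> e'"
      using that(3) irF by (auto simp: irrefl_def)
    then have "(e', e) \<in> edge_less G"
      using that(1,2) no totG by (auto simp: total_on_def)
    then have "(f ` e, f ` e) \<in> edge_less F"
      using mono that(3) transD[OF trF] by blast
    then show False
      using irF by (auto simp: irrefl_def)
  qed
  have "edge_less (relabel f G) = edge_less F \<inter> (edges (relabel f G) \<times> edges (relabel f G))"
    (is "?L = ?R")
  proof
    show "?L \<subseteq> ?R"
      using mono G by (auto simp: relabel_def edge_ordered_graph_def)
    show "?R \<subseteq> ?L"
    proof (rule subrelI)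
      fix x y
      assume xy: "(x, y) \<in> ?R"
      then have "x \<in> edges (relabel f G)" "y \<in> edges (relabel f G)" by simp_all
      then obtain a b where ab: "a \<in> edges G" "b \<in> edges G" and eq: "x = f ` a" "y = f ` b"
        unfolding relabel_def by auto
      have "(a, b) \<in> edge_less G"
        using reflects ab xy unfolding eq by simp
      then show "(x, y) \<in> ?L"
        using edge_less_relabel_iff[OF G inj ab] unfolding eq by simp
    qed
  qed
  moreover have "verts (relabel f G) \<subseteq> verts F" "edges (relabel f G) \<subseteq> edges F"
    using f by (auto simp: eo_embedding_def relabel_def)
  ultimately show ?thesis
    using F edge_ordered_graph_relabel[OF G inj] eo_isomorphic_relabel[OF G inj]
    by (simp add: eo_copy_def eo_subgraph_def)
qed

lemma eo_embedding_relabel_comp: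
  assumes "eo_embedding f G F" "inj_on g (verts F)"
  shows "eo_embedding (g \<circ> f) G (relabel g F)"
  unfolding eo_embedding_def
proof (intro conjI allI ballI impI)
  show "inj_on (g \<circ> f) (verts G)"
    using assms by (intro comp_inj_on) (auto simp: eo_embedding_def intro: inj_on_subset)
  show "(g \<circ> f) ` verts G \<subseteq> verts (relabel g F)"
    using assms(1) by (auto simp: eo_embedding_def relabel_def)
  show "(g \<circ> f) ` e \<in> edges (relabel g F)" if "e \<in> edges G" for e
    using assms(1) that by (auto simp: eo_embedding_def relabel_def image_comp[symmetric])
  show "((g \<circ> f) ` e, (g \<circ> f) ` e') \<in> edge_less (relabel g F)"
    if "(e, e') \<in> edge_less G" for e e'
  proof -
    have "(f ` e, f ` e') \<in> edge_less F"
      using assms(1) that by (auto simp: eo_embedding_def)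
    then have "map_prod (\<lambda>e. g ` e) (\<lambda>e. g ` e) (f ` e, f ` e') \<in> edge_less (relabel g F)"
      unfolding relabel_def eograph.simps by (rule imageI)
    then show ?thesis
      by (simp add: image_comp)
  qed
qed

text \<open>
  Hosts in the definition of the Ramsey number live on \<^typ>\<open>nat\<close>. Encoding a countable vertex type
  injectively and pulling colourings back along the encoding makes
  \<^const>\<open>ordered_biclique\<close>, whose vertices form a sum type, available as a host.
\<close>

lemma size_edge_ramsey_le:
  fixes F :: "'c::countable eograph"
  assumes G: "edge_ordered_graph G" and H: "edge_ordered_graph H" and F: "edge_ordered_graph F"
    and arrows: "\<And>c :: 'c set \<Rightarrow> colour.
      (\<exists>f. eo_embedding f G F \<and> (\<forall>e\<in>edges G. c (f ` e) = Red)) \<or>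
      (\<exists>f. eo_embedding f H F \<and> (\<forall>e\<in>edges H. c (f ` e) = Blue))"
  shows "size_edge_ramsey G H \<le> enat (card (edges F))"
proof -
  define g :: "'c \<Rightarrow> nat" where "g = to_nat"
  have inj: "inj_on g (verts F)"
    unfolding g_def by (rule inj_on_subset[OF inj_to_nat]) simp
  let ?F = "relabel g F"
  have F': "edge_ordered_graph ?F"
    using F inj by (rule edge_ordered_graph_relabel)
  have "card (edges ?F) = card (edges F)"
    unfolding relabel_def using card_image[OF inj_on_image_edges[OF F inj]] by simp
  moreover have "edge_arrows ?F G H"
    unfolding edge_arrows_def
  proof
    fix c :: "nat set \<Rightarrow> colour"
    have copyG: "\<exists>C. eo_copy G ?F C \<and> (\<forall>e\<in>edges C. c e = Red)"
      if "eo_embedding f G F" "\<forall>e\<in>edges G. c (g ` f ` e) = Red" for f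
      using that eo_copy_relabel[OF G F' eo_embedding_relabel_comp[OF that(1) inj]]
      by (intro exI[of _ "relabel (g \<circ> f) G"]) (auto simp: relabel_def image_comp)
    have copyH: "\<exists>C. eo_copy H ?F C \<and> (\<forall>e\<in>edges C. c e = Blue)"
      if "eo_embedding f H F" "\<forall>e\<in>edges H. c (g ` f ` e) = Blue" for f
      using that eo_copy_relabel[OF H F' eo_embedding_relabel_comp[OF that(1) inj]]
      by (intro exI[of _ "relabel (g \<circ> f) H"]) (auto simp: relabel_def image_comp)
    show "(\<exists>C. eo_copy G ?F C \<and> (\<forall>e\<in>edges C. c e = Red)) \<or>
          (\<exists>C. eo_copy H ?F C \<and> (\<forall>e\<in>edges C. c e = Blue))"
      using arrows[of "\<lambda>e. c (g ` e)"] copyG copyH by blast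
  qed
  ultimately show ?thesis
    unfolding size_edge_ramsey_def using F' by (intro Inf_lower) blast
qed

section \<open>Stars and bicliques inside a biclique\<close>

lemma ex_strict_mono_on_into:
  fixes J :: "nat set"
  assumes "finite J" "k \<le> card J"
  shows "\<exists>h. strict_mono_on {1..k} h \<and> h ` {1..k} \<subseteq> J"
proof -
  obtain h where h: "bij_betw h {..<card J} J" "strict_mono_on {..<card J} h"
    using ex_bij_betw_strict_mono_card[OF assms(1)] by blast
  have "strict_mono_on {1..k} (\<lambda>i. h (i - 1))"
  proof (rule strict_mono_onI)
    fix r s :: nat
    assume "r \<in> {1..k}" "s \<in> {1..k}" "r < s"
    then show "h (r - 1) < h (s - 1)"
      using assms(2) by (intro strict_mono_onD[OF h(2)]) auto
  qed
  moreover have "(\<lambda>i. h (i - 1)) ` {1..k} \<subseteq> J"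
  proof
    fix x
    assume "x \<in> (\<lambda>i. h (i - 1)) ` {1..k}"
    then obtain i where i: "i \<in> {1..k}" "x = h (i - 1)"
      by auto
    then have "i - 1 \<in> {..<card J}"
      using assms(2) by auto
    then show "x \<in> J"
      using h(1) i(2) by (auto simp: bij_betw_def)
  qed
  ultimately show ?thesis by blast
qed

lemma ordered_biclique_edgeI:
  assumes "i \<in> {1..s}" "j \<in> {1..t}"
  shows "{Inl i, Inr j} \<in> edges (ordered_biclique s t)"
  unfolding ordered_biclique_def eograph.simps
  by (intro CollectI exI conjI) (rule refl assms)+

lemma ordered_biclique_edge_lessI:
  assumes "i \<in> {1..s}" "j \<in> {1..t}" "k \<in> {1..s}" "l \<in> {1..t}" "i < k \<or> i = k \<and> j < l"
  shows "({Inl i, Inr j}, {Inl k, Inr l}) \<in> edge_less (ordered_biclique s t)"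
  unfolding ordered_biclique_def eograph.simps
  by (rule CollectI, rule exI[of _ i], rule exI[of _ j], rule exI[of _ k], rule exI[of _ l])
    (intro conjI refl assms)

lemma eo_embedding_star_biclique:
  assumes h: "strict_mono_on {1..n} h" "h ` {1..n} \<subseteq> {1..m}" and i: "i \<in> {1..s}"
  shows "eo_embedding (\<lambda>x. if x = 0 then Inl i else Inr (h x))
           (ordered_star n) (ordered_biclique s m)"
proof -
  let ?f = "\<lambda>x. if x = 0 then Inl i else Inr (h x)"
  have inj: "inj_on h {1..n}"
    using h(1) by (rule strict_mono_on_imp_inj_on)
  have range: "h j \<in> {1..m}" if "j \<in> {1..n}" for j
    using h(2) that by blast
  have im: "?f ` {0, j} = {Inl i, Inr (h j)}" if "j \<in> {1..n}" for j
    using that by auto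
  show ?thesis
    unfolding eo_embedding_def
  proof (intro conjI allI ballI impI)
    show "inj_on ?f (verts (ordered_star n))"
    proof (rule inj_onI)
      fix x y
      assume "x \<in> verts (ordered_star n)" "y \<in> verts (ordered_star n)" and eq: "?f x = ?f y"
      then have "x \<le> n" "y \<le> n"
        by (simp_all add: ordered_star_def)
      then show "x = y"
        using eq inj_onD[OF inj, of x y] by (cases "x = 0"; cases "y = 0") simp_all
    qed
    show "?f ` verts (ordered_star n) \<subseteq> verts (ordered_biclique s m)"
    proof (rule image_subsetI)
      fix x
      assume "x \<in> verts (ordered_star n)"
      then have "x \<le> n"
        by (simp add: ordered_star_def)
      then show "?f x \<in> verts (ordered_biclique s m)"
        using i range[of x] by (cases "x = 0") (simp_all add: ordered_biclique_def)
    qed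
    fix e
    assume "e \<in> edges (ordered_star n)"
    then obtain j where "j \<in> {1..n}" "e = {0, j}"
      by (auto simp: ordered_star_def)
    then show "?f ` e \<in> edges (ordered_biclique s m)"
      using ordered_biclique_edgeI[OF i range[of j]] im[of j] by simp
  next
    fix e e'
    assume "(e, e') \<in> edge_less (ordered_star n)"
    then obtain j k where jk: "j \<in> {1..n}" "k \<in> {1..n}" "j < k" and e: "e = {0, j}" "e' = {0, k}"
      by (auto simp: ordered_star_def)
    have "h j < h k"
      using strict_mono_onD[OF h(1)] jk by blast
    then have "({Inl i, Inr (h j)}, {Inl i, Inr (h k)}) \<in> edge_less (ordered_biclique s m)"
      using i range jk by (intro ordered_biclique_edge_lessI) auto
    then show "(?f ` e, ?f ` e') \<in> edge_less (ordered_biclique s m)"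
      unfolding e im[OF jk(1)] im[OF jk(2)] .
  qed
qed

lemma eo_embedding_biclique_biclique:
  assumes h: "strict_mono_on {1..t} h" "h ` {1..t} \<subseteq> {1..m}"
  shows "eo_embedding (map_sum id h) (ordered_biclique s t) (ordered_biclique s m)"
proof -
  have inj: "inj_on h {1..t}"
    using h(1) by (rule strict_mono_on_imp_inj_on)
  have range: "h j \<in> {1..m}" if "j \<in> {1..t}" for j
    using h(2) that by blast
  have im: "map_sum id h ` {Inl i, Inr j} = {Inl i, Inr (h j)}" for i :: nat and j
    by simp
  show ?thesis
    unfolding eo_embedding_def
  proof (intro conjI allI ballI impI)
    show "inj_on (map_sum id h) (verts (ordered_biclique s t))"
    proof (rule inj_onI)
      fix x y
      assume "x \<in> verts (ordered_biclique s t)" "y \<in> verts (ordered_biclique s t)"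
        and eq: "map_sum id h x = map_sum id h y"
      then show "x = y"
        by (cases x; cases y)
          (simp_all add: ordered_biclique_def image_iff inj_on_eq_iff[OF inj])
    qed
    show "map_sum id h ` verts (ordered_biclique s t) \<subseteq> verts (ordered_biclique s m)"
      using h(2) unfolding ordered_biclique_def eograph.simps
      by (simp add: image_Un image_image) blast
    fix e
    assume "e \<in> edges (ordered_biclique s t)"
    then obtain i j where "i \<in> {1..s}" "j \<in> {1..t}" "e = {Inl i, Inr j}"
      by (auto simp: ordered_biclique_def)
    then show "map_sum id h ` e \<in> edges (ordered_biclique s m)"
      using ordered_biclique_edgeI[OF _ range[of j]] im[of i j] by simp
  next
    fix e e'
    assume "(e, e') \<in> edge_less (ordered_biclique s t)"
    then obtain i j k l where ij: "i \<in> {1..s}" "j \<in> {1..t}" "k \<in> {1..s}" "l \<in> {1..t}"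
      and less: "i < k \<or> i = k \<and> j < l" and e: "e = {Inl i, Inr j}" "e' = {Inl k, Inr l}"
      by (auto simp: ordered_biclique_def)
    have "i < k \<or> i = k \<and> h j < h l"
      using strict_mono_onD[OF h(1)] ij less by blast
    then have "({Inl i, Inr (h j)}, {Inl k, Inr (h l)}) \<in> edge_less (ordered_biclique s m)"
      using range ij by (intro ordered_biclique_edge_lessI) auto
    then show "(map_sum id h ` e, map_sum id h ` e') \<in> edge_less (ordered_biclique s m)"
      unfolding e im .
  qed
qed

lemma card_edges_ordered_star: "card (edges (ordered_star n)) = n"
proof -
  have "edges (ordered_star n) = (\<lambda>i. {0, i}) ` {1..n}"
    by (auto simp: ordered_star_def)
  moreover have "inj_on (\<lambda>i::nat. {0, i}) {1..n}"
    by (auto simp: inj_on_def doubleton_eq_iff)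
  ultimately show ?thesis
    by (simp add: card_image)
qed

lemma card_edges_ordered_biclique: "card (edges (ordered_biclique s t)) = s * t"
proof -
  have "edges (ordered_biclique s t) = (\<lambda>(i, j). {Inl i, Inr j}) ` ({1..s} \<times> {1..t})"
    (is "_ = ?f ` _")
  proof
    show "edges (ordered_biclique s t) \<subseteq> ?f ` ({1..s} \<times> {1..t})"
      by (auto simp: ordered_biclique_def)
    show "?f ` ({1..s} \<times> {1..t}) \<subseteq> edges (ordered_biclique s t)"
      using ordered_biclique_edgeI by auto
  qed
  moreover have "inj_on (\<lambda>(i::nat, j::nat). {Inl i, Inr j}) ({1..s} \<times> {1..t})"
    by (auto simp: inj_on_def doubleton_eq_iff)
  ultimately show ?thesis
    by (simp add: card_image card_cartesian_product)
qed

text \<open>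
  A count of red neighbourhoods: if \<open>n\<close> red edges meet at some \<open>Inl i\<close>, they form the star;
  otherwise the red neighbourhoods cover at most \<open>s * (n - 1)\<close> vertices of the second part, and
  the remaining ones, at least \<open>t\<close>, see only blue edges.
\<close>

lemma biclique_red_star_or_blue_biclique:
  fixes c :: "(nat + nat) set \<Rightarrow> colour"
  assumes m: "m = s * (n - 1) + t"
  shows "(\<exists>f. eo_embedding f (ordered_star n) (ordered_biclique s m) \<and>
            (\<forall>e\<in>edges (ordered_star n). c (f ` e) = Red)) \<or>
         (\<exists>f. eo_embedding f (ordered_biclique s t) (ordered_biclique s m) \<and>
            (\<forall>e\<in>edges (ordered_biclique s t). c (f ` e) = Blue))"
proof -
  define R where "R i = {j \<in> {1..m}. c {Inl i, Inr j} = Red}" for i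
  have fin: "finite (R i)" and R_sub: "R i \<subseteq> {1..m}" for i
    by (auto simp: R_def)
  show ?thesis
  proof (cases "\<exists>i\<in>{1..s}. n \<le> card (R i)")
    case True
    then obtain i where i: "i \<in> {1..s}" "n \<le> card (R i)" by blast
    obtain h where h: "strict_mono_on {1..n} h" "h ` {1..n} \<subseteq> R i"
      using ex_strict_mono_on_into[OF fin i(2)] by blast
    let ?f = "\<lambda>x. if x = 0 then Inl i else Inr (h x)"
    have "eo_embedding ?f (ordered_star n) (ordered_biclique s m)"
      using h R_sub i(1) by (intro eo_embedding_star_biclique) blast+
    moreover have "c (?f ` e) = Red" if e: "e \<in> edges (ordered_star n)" for e
    proof -
      obtain j where j: "j \<in> {1..n}" "e = {0, j}"
        using e by (auto simp: ordered_star_def)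
      have "?f ` e = {Inl i, Inr (h j)}"
        using j by auto
      moreover have "h j \<in> R i"
        using h(2) j(1) by blast
      ultimately show ?thesis
        by (simp add: R_def)
    qed
    ultimately show ?thesis by blast
  next
    case False
    let ?J = "{1..m} - (\<Union>i\<in>{1..s}. R i)"
    have few: "card (R i) \<le> n - 1" if "i \<in> {1..s}" for i
    proof -
      have "\<not> n \<le> card (R i)"
        using False that by blast
      then show ?thesis by simp
    qed
    have "card (\<Union>i\<in>{1..s}. R i) \<le> (\<Sum>i\<in>{1..s}. card (R i))"
      by (rule card_UN_le) simp
    also have "\<dots> \<le> (\<Sum>i\<in>{1..s}. n - 1)"
      using few by (rule sum_mono)
    finally have "card (\<Union>i\<in>{1..s}. R i) \<le> s * (n - 1)" by simp
    moreover have "card {1..m} - card (\<Union>i\<in>{1..s}. R i) \<le> card ?J"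
      using fin by (intro diff_card_le_card_Diff) auto
    ultimately have "t \<le> card ?J"
      using m by simp
    then obtain h where h: "strict_mono_on {1..t} h" "h ` {1..t} \<subseteq> ?J"
      using ex_strict_mono_on_into[of ?J t] by auto
    have "eo_embedding (map_sum id h) (ordered_biclique s t) (ordered_biclique s m)"
      using h by (intro eo_embedding_biclique_biclique) blast+
    moreover have "c (map_sum id h ` e) = Blue" if e: "e \<in> edges (ordered_biclique s t)" for e
    proof -
      obtain i j where ij: "i \<in> {1..s}" "j \<in> {1..t}" "e = {Inl i, Inr j}"
        using e by (auto simp: ordered_biclique_def)
      have "h j \<in> {1..m}" "h j \<notin> R i"
        using h(2) ij(1,2) by blast+
      then have "c {Inl i, Inr (h j)} \<noteq> Red"
        by (simp add: R_def)
      then show ?thesis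
        using ij(3) by (cases "c {Inl i, Inr (h j)}") auto
    qed
    ultimately show ?thesis by blast
  qed
qed

lemma size_edge_ramsey_star_biclique_le:
  "size_edge_ramsey (ordered_star n) (ordered_biclique s t) \<le> enat (s ^ 2 * (n - 1) + s * t)"
proof -
  define m where "m = s * (n - 1) + t"
  have "size_edge_ramsey (ordered_star n) (ordered_biclique s t)
          \<le> enat (card (edges (ordered_biclique s m)))"
    by (intro size_edge_ramsey_le edge_ordered_graph_ordered_star
        edge_ordered_graph_ordered_biclique biclique_red_star_or_blue_biclique m_def)
  also have "card (edges (ordered_biclique s m)) = s ^ 2 * (n - 1) + s * t"
    by (simp add: card_edges_ordered_biclique m_def power2_eq_square algebra_simps)
  finally show ?thesis .
qed

section \<open>The counting lower bound\<close>

lemma card_edges_eo_isomorphic: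
  assumes G: "edge_ordered_graph G" and C: "edge_ordered_graph C" and iso: "eo_isomorphic G C"
  shows "card (edges C) = card (edges G)"
proof -
  obtain f where bij: "bij_betw f (verts G) (verts C)"
    and edge: "\<forall>u\<in>verts G. \<forall>v\<in>verts G. {u, v} \<in> edges G \<longleftrightarrow> {f u, f v} \<in> edges C"
    using iso unfolding eo_isomorphic_def by blast
  have inj: "inj_on f (verts G)" and im: "f ` verts G = verts C"
    using bij by (auto simp: bij_betw_def)
  have "(\<lambda>e. f ` e) ` edges G = edges C"
  proof (intro equalityI subsetI)
    fix d
    assume "d \<in> (\<lambda>e. f ` e) ` edges G"
    then obtain e where e: "e \<in> edges G" "d = f ` e" by blast
    then have "e \<subseteq> verts G" "card e = 2"
      using G by (auto simp: edge_ordered_graph_def)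
    moreover from this obtain u v where "e = {u, v}"
      by (auto simp: card_2_iff)
    ultimately show "d \<in> edges C"
      using edge e by auto
  next
    fix d
    assume d: "d \<in> edges C"
    then have "d \<subseteq> verts C" "card d = 2"
      using C by (auto simp: edge_ordered_graph_def)
    moreover from this obtain x y where xy: "d = {x, y}"
      by (auto simp: card_2_iff)
    ultimately have "x \<in> f ` verts G" "y \<in> f ` verts G"
      using im by simp_all
    then obtain u v where uv: "u \<in> verts G" "v \<in> verts G" "x = f u" "y = f v"
      by (elim imageE)
    then have "{u, v} \<in> edges G"
      using edge d xy uv by simp
    moreover have "d = f ` {u, v}"
      using xy uv by simp
    ultimately show "d \<in> (\<lambda>e. f ` e) ` edges G"
      by (rule rev_image_eqI)
  qed
  then show ?thesis
    using card_image[OF inj_on_image_edges[OF G inj]] by metis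
qed

lemma card_edges_eo_copy:
  assumes "edge_ordered_graph G" "eo_copy G F C"
  shows "card (edges C) = card (edges G)" and "edges C \<subseteq> edges F"
  using assms card_edges_eo_isomorphic[of G C] by (auto simp: eo_copy_def eo_subgraph_def)

text \<open>
  A host that is too small is coloured red on (up to) \<open>e(G) - 1\<close> edges and blue elsewhere. Both
  graphs must have edges: for an edgeless \<open>G\<close> a host without edges may suffice, whatever \<open>H\<close> is.
\<close>

lemma size_edge_ramsey_ge:
  assumes G: "edge_ordered_graph G" and H: "edge_ordered_graph H"
    and pos: "card (edges G) \<ge> 1" "card (edges H) \<ge> 1"
  shows "enat (card (edges G) + card (edges H) - 1) \<le> size_edge_ramsey G H"
  unfolding size_edge_ramsey_def
proof (rule Inf_greatest)
  fix x
  assume "x \<in> {enat N | N. \<exists>F :: nat eograph.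
      edge_ordered_graph F \<and> card (edges F) = N \<and> edge_arrows F G H}"
  then obtain F :: "nat eograph" where x: "x = enat (card (edges F))"
    and F: "edge_ordered_graph F" and arrows: "edge_arrows F G H"
    by blast
  have fin: "finite (edges F)"
    using F by (rule finite_edges)
  have "card (edges G) + card (edges H) - 1 \<le> card (edges F)"
  proof (rule ccontr)
    assume "\<not> ?thesis"
    then have small: "card (edges F) < card (edges G) + card (edges H) - 1" by simp
    obtain R where R: "R \<subseteq> edges F" "card R = min (card (edges F)) (card (edges G) - 1)"
      by (rule obtain_subset_with_card_n[OF min.cobounded1])
    have finR: "finite R"
      using R(1) fin by (rule finite_subset)
    define c where "c e = (if e \<in> R then Red else Blue)" for e
    have c_simps: "c e = Red \<longleftrightarrow> e \<in> R" "c e = Blue \<longleftrightarrow> e \<notin> R" for e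
      by (auto simp: c_def)
    from arrows consider
        C where "eo_copy G F C" "\<forall>e\<in>edges C. c e = Red"
      | C where "eo_copy H F C" "\<forall>e\<in>edges C. c e = Blue"
      unfolding edge_arrows_def by blast
    then show False
    proof cases
      case 1
      then have "edges C \<subseteq> R"
        by (auto simp: c_simps)
      then have "card (edges G) \<le> card R"
        using card_mono[OF finR] card_edges_eo_copy(1)[OF G 1(1)] by metis
      then show False
        using R(2) pos by linarith
    next
      case 2
      then have "edges C \<subseteq> edges F - R"
        using card_edges_eo_copy(2)[OF H 2(1)] by (auto simp: c_simps)
      then have "card (edges H) \<le> card (edges F - R)"
        using card_mono[of "edges F - R" "edges C"] fin card_edges_eo_copy(1)[OF H 2(1)] by simp
      also have "\<dots> = card (edges F) - card R"
        using finR R(1) by (rule card_Diff_subset)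
      finally show False
        using R(2) small pos by linarith
    qed
  qed
  then show "enat (card (edges G) + card (edges H) - 1) \<le> x"
    using x by simp
qed

lemma size_edge_ramsey_star_star:
  assumes "n \<ge> 1" "t \<ge> 1"
  shows "size_edge_ramsey (ordered_star n) (ordered_biclique 1 t) = enat (n - 1 + t)"
proof (rule antisym)
  show "size_edge_ramsey (ordered_star n) (ordered_biclique 1 t) \<le> enat (n - 1 + t)"
    using size_edge_ramsey_star_biclique_le[of n 1 t] by simp
  show "enat (n - 1 + t) \<le> size_edge_ramsey (ordered_star n) (ordered_biclique 1 t)"
    using size_edge_ramsey_ge[of "ordered_star n" "ordered_biclique 1 t"] assms
    by (simp add: edge_ordered_graph_ordered_star edge_ordered_graph_ordered_biclique
        card_edges_ordered_star card_edges_ordered_biclique)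
qed

theorem theorem3p6:
  "(\<forall>n s t :: nat. n \<ge> 1 \<and> s \<ge> 1 \<and> t \<ge> 1 \<longrightarrow>
      size_edge_ramsey (ordered_star n) (ordered_biclique s t)
        \<le> enat (s ^ 2 * (n - 1) + s * t)) \<and>
   (\<exists>n s t :: nat. n \<ge> 1 \<and> s \<ge> 1 \<and> t \<ge> 1 \<and>
      size_edge_ramsey (ordered_star n) (ordered_biclique s t)
        = enat (s ^ 2 * (n - 1) + s * t))"
proof (intro conjI allI impI)
  fix n s t :: nat
  show "size_edge_ramsey (ordered_star n) (ordered_biclique s t)
          \<le> enat (s ^ 2 * (n - 1) + s * t)"
    by (rule size_edge_ramsey_star_biclique_le)
next
  have "size_edge_ramsey (ordered_star 2) (ordered_biclique 1 2)
          = enat (1 ^ 2 * (2 - 1) + 1 * 2)"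
    using size_edge_ramsey_star_star[of 2 2] by simp
  then show "\<exists>n s t :: nat. n \<ge> 1 \<and> s \<ge> 1 \<and> t \<ge> 1 \<and>
      size_edge_ramsey (ordered_star n) (ordered_biclique s t)
        = enat (s ^ 2 * (n - 1) + s * t)"
    by (metis one_le_numeral order_refl)
qed

end
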